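(* Let $x\ge 0$ be real and let $a,b,m$ be integers such that $1\le a<b\le m$. Assume that there exists a positive integer $k$ with $k\mid (b-a)$ such that neither of the congruences $$2^{h}k\equiv a\pmod m\quad\text{and}\quad 2^{h}k\equiv b\pmod m$$ possesses a solution for any $h\in\mathbb{N}$ (where $\mathbb{N}$ is the set of positive integers). Then for all integers $n\ge 0$ we have $$p_{n}(a,b,m; x,1)\ge p_{n}(b,a,m; x,1).$$
   Context: A partition $\lambda$ is a finite nonincreasing sequence of positive integers (its parts), possibly empty; $\ell(\lambda)$ is its number of parts and $|\lambda|$ the sum of its parts (so $\ell(\varnothing)=|\varnothing|=0$). $\mathcal{P}$ is the set of all partitions and $\mathcal{D}$ the set of all partitions with pairwise distinct parts. For integers $m\ge 1$ and $1\le c\le m$, $\ell_{c,m}(\lambda)$ is the number of parts of $\lambda$ congruent to $c$ modulo $m$, and $\ell_{c,m}(\lambda,\mu):=\ell_{c,m}(\lambda)+\ell_{c,m}(\mu)$ for $(\lambda,\mu)\in\mathcal{P}\times\mathcal{D}$. For residues $a\neq b$ in $\{1,\dots,m\}$, real $x,y\ge 0$ and integer $n\ge 0$, define $$p_{n}(a,b,m; x,y):=\sum_{\substack{(\lambda, \mu)\in\mathcal{P}\times \mathcal{D}\\ |\lambda|+|\mu|=n\\ \ell_{a,m}(\lambda,\mu)> \ell_{b,m}(\lambda,\mu)}} x^{\ell(\lambda)}y^{\ell(\mu)},$$ with the convention $0^0=1$. *)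

theory Defs
  imports Complex_Main "HOL-Number_Theory.Cong"
begin

definition partitions :: "nat list set" where
  "partitions = {la. sorted_wrt (\<ge>) la \<and> (\<forall>p \<in> set la. 0 < p)}"

definition distinct_partitions :: "nat list set" where
  "distinct_partitions = {mu \<in> partitions. distinct mu}"

definition parts_mod :: "nat \<Rightarrow> nat \<Rightarrow> nat list \<Rightarrow> nat" where
  "parts_mod c m la = length (filter (\<lambda>p. [p = c] (mod m)) la)"

definition parts_mod2 :: "nat \<Rightarrow> nat \<Rightarrow> nat list \<Rightarrow> nat list \<Rightarrow> nat" where
  "parts_mod2 c m la mu = parts_mod c m la + parts_mod c m mu"

definition biased_pairs :: "nat \<Rightarrow> nat \<Rightarrow> nat \<Rightarrow> nat \<Rightarrow> (nat list \<times> nat list) set" where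
  "biased_pairs n a b m =
     {(la, mu) \<in> partitions \<times> distinct_partitions.
        sum_list la + sum_list mu = n \<and> parts_mod2 a m la mu > parts_mod2 b m la mu}"

definition p_bias :: "nat \<Rightarrow> nat \<Rightarrow> nat \<Rightarrow> nat \<Rightarrow> real \<Rightarrow> real \<Rightarrow> real" where
  "p_bias n a b m x y = (\<Sum>(la, mu) \<in> biased_pairs n a b m. x ^ length la * y ^ length mu)"

(* The sum in p_bias ranges over a finite set, so it is never the default value 0
   that sum takes on infinite sets. *)
lemma finite_biased_pairs: "finite (biased_pairs n a b m)"
proof -
  have len: "length la \<le> sum_list la" if "\<forall>p \<in> set la. 0 < p" for la :: "nat list"
    using that by (induction la) (auto simp: Suc_le_eq intro: add_less_le_mono)
  let ?S = "{la :: nat list. set la \<subseteq> {..n} \<and> length la \<le> n}"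
  have *: "la \<in> ?S" if "la \<in> partitions" "sum_list la \<le> n" for la
    using that len[of la] member_le_sum_list[of _ la]
    by (fastforce simp: partitions_def)
  have "biased_pairs n a b m \<subseteq> ?S \<times> ?S"
  proof
    fix q assume "q \<in> biased_pairs n a b m"
    then obtain la mu where "q = (la, mu)" "la \<in> partitions" "mu \<in> partitions"
      "sum_list la + sum_list mu = n"
      unfolding biased_pairs_def distinct_partitions_def by blast
    then show "q \<in> ?S \<times> ?S"
      using *[of la] *[of mu] by simp
  qed
  moreover have "finite (?S \<times> ?S)"
    by (intro finite_cartesian_product finite_lists_length_le) auto
  ultimately show ?thesis by (rule finite_subset)
qed

end

theory Submission
  imports Defs "HOL-Library.Multiset" "HOL-Library.Nat_Bijection"
begin

text \<open>
  Exchanging \<open>a + i m\<close> with \<open>b + i m\<close> in both partitions reverses the bias, preserves the numbers of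
  parts, and turns a pair with \<open>d > 0\<close> more parts congruent to \<open>b\<close> than to \<open>a\<close> into a pair whose total
  is smaller by \<open>(b - a) d\<close>.  The loss is made up inside a set \<open>S\<close> of parts of \<open>\<mu>\<close> that avoid
  both residue classes and whose subset sums are pairwise distinct and closed under adding \<open>b - a\<close>;
  as \<open>y = 1\<close>, changing the number of these parts does not affect the weight.

  If \<open>k \<noteq> a\<close>, then \<open>S = {k, 2k, 4k, \<dots>}\<close> works, with all multiples of \<open>k\<close> as subset sums.  If \<open>k = a\<close>,
  then \<open>k\<close> itself is not available.  When \<open>2a\<close> divides \<open>b - a\<close>, replace \<open>k\<close> by \<open>2a\<close>.  Otherwise take
  \<open>S = {2a, 4a, 8a, \<dots>} \<union> {3a}\<close>, whose subset sums represent every multiple of \<open>a\<close> other than \<open>a\<close>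
  exactly once.
\<close>

section \<open>Partitions as sorted lists, and counting parts in a residue class\<close>

definition desc :: "nat list \<Rightarrow> nat list" where
  "desc xs = rev (sort xs)"

lemma mset_desc [simp]: "mset (desc xs) = mset xs"
  by (simp add: desc_def)

lemma set_desc [simp]: "set (desc xs) = set xs"
  by (simp add: desc_def)

lemma length_desc [simp]: "length (desc xs) = length xs"
  by (simp add: desc_def)

lemma distinct_desc [simp]: "distinct (desc xs) = distinct xs"
  by (simp add: desc_def)

lemma sum_list_desc [simp]: "sum_list (desc xs) = sum_list xs"
  by (metis mset_desc sum_mset_sum_list)

lemma desc_in_partitions: "(\<And>p. p \<in> set xs \<Longrightarrow> 0 < p) \<Longrightarrow> desc xs \<in> partitions"
  by (simp add: partitions_def desc_def sorted_wrt_rev)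

text \<open>Sorting is canonical, so injectivity of a map on partitions can be tested on multisets
  of parts.\<close>

lemma partitions_eqI:
  assumes "la \<in> partitions" "mu \<in> partitions" "mset la = mset mu"
  shows "la = mu"
proof -
  have "sorted (rev la)" "sorted (rev mu)"
    using assms by (simp_all add: partitions_def sorted_wrt_rev)
  moreover have "mset (rev la) = mset (rev mu)" using assms by simp
  ultimately have "rev la = rev mu"
    by (metis properties_for_sort)
  then show ?thesis by simp
qed

lemma parts_mod_mset: "parts_mod c m xs = size (filter_mset (\<lambda>p. [p = c] (mod m)) (mset xs))"
  by (simp add: parts_mod_def flip: mset_filter)

lemma parts_mod_desc [simp]: "parts_mod c m (desc xs) = parts_mod c m xs"
  by (simp add: parts_mod_mset)

lemma parts_mod_append [simp]: "parts_mod c m (xs @ ys) = parts_mod c m xs + parts_mod c m ys"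
  by (simp add: parts_mod_def)

lemma parts_mod_eq_0: "(\<And>p. p \<in> set xs \<Longrightarrow> \<not> [p = c] (mod m)) \<Longrightarrow> parts_mod c m xs = 0"
  by (simp add: parts_mod_def filter_empty_conv)

lemma sum_list_split_filter:
  fixes xs :: "nat list"
  shows "sum_list (filter (\<lambda>p. p \<notin> S) xs) + sum_list (filter (\<lambda>p. p \<in> S) xs) = sum_list xs"
  by (induction xs) auto

lemma parts_mod_filter_notin:
  assumes "\<And>p. p \<in> S \<Longrightarrow> \<not> [p = c] (mod m)"
  shows "parts_mod c m (filter (\<lambda>p. p \<notin> S) xs) = parts_mod c m xs"
  using assms by (induction xs) (auto simp: parts_mod_def)

section \<open>Exchanging the residue classes of \<open>a\<close> and \<open>b\<close>, and the
  injection built on it\<close>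

locale residue_pair =
  fixes a b m :: nat
  assumes a_pos: "1 \<le> a" and a_less_b: "a < b" and b_le_m: "b \<le> m"
begin

definition swap :: "nat \<Rightarrow> nat" where
  "swap p = (if [p = a] (mod m) then p + (b - a) else if [p = b] (mod m) then p - (b - a) else p)"

lemma not_cong_a_b: "\<not> [a = b] (mod m)"
  using a_pos a_less_b b_le_m by (cases "b = m") (auto simp: cong_def)

text \<open>As \<open>b \<le> m\<close>, \<open>b\<close> is the least positive member of its class;
  for \<open>b = m\<close> the class consists of the multiples of \<open>m\<close>. Hence the
  truncated subtraction in \<open>swap\<close> is exact on positive parts.\<close>

lemma cong_b_imp_le: "0 < p \<Longrightarrow> [p = b] (mod m) \<Longrightarrow> b \<le> p"
  using b_le_m mod_less_eq_dividend[of p m]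
  by (cases "b = m") (simp_all add: cong_def dvd_imp_le mod_eq_0_iff_dvd)

lemma cong_shift: "[p + (b - a) = b] (mod m) \<longleftrightarrow> [p = a] (mod m)"
proof -
  have "[p + (b - a) = a + (b - a)] (mod m) \<longleftrightarrow> [p = a] (mod m)"
    by (rule cong_add_rcancel_nat)
  then show ?thesis using a_less_b by simp
qed

lemma swap_pos: "0 < p \<Longrightarrow> 0 < swap p"
  using cong_b_imp_le[of p] a_pos a_less_b by (auto simp: swap_def)

lemma cong_swap_b: "0 < p \<Longrightarrow> [swap p = b] (mod m) \<longleftrightarrow> [p = a] (mod m)"
  and cong_swap_a: "0 < p \<Longrightarrow> [swap p = a] (mod m) \<longleftrightarrow> [p = b] (mod m)"
proof -
  assume p: "0 < p"
  consider "[p = a] (mod m)" | "\<not> [p = a] (mod m)" "[p = b] (mod m)"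
    | "\<not> [p = a] (mod m)" "\<not> [p = b] (mod m)" by blast
  then have "([swap p = b] (mod m) \<longleftrightarrow> [p = a] (mod m)) \<and> ([swap p = a] (mod m) \<longleftrightarrow> [p = b] (mod m))"
  proof cases
    case 1
    then have "[swap p = b] (mod m)" by (simp add: swap_def cong_shift)
    with 1 show ?thesis using not_cong_a_b by (meson cong_sym cong_trans)
  next
    case 2
    then have "b \<le> p" using p cong_b_imp_le by blast
    then have "[swap p + (b - a) = b] (mod m)" using 2 by (simp add: swap_def)
    then have "[swap p = a] (mod m)" by (simp add: cong_shift)
    with 2 show ?thesis using not_cong_a_b by (meson cong_sym cong_trans)
  qed (simp add: swap_def)
  then show "[swap p = b] (mod m) \<longleftrightarrow> [p = a] (mod m)" "[swap p = a] (mod m) \<longleftrightarrow> [p = b] (mod m)"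
    by auto
qed

lemma swap_swap: "0 < p \<Longrightarrow> swap (swap p) = p"
  using cong_swap_a[of p] cong_swap_b[of p] cong_b_imp_le[of p] not_cong_a_b
  \<comment> \<open>The outer \<open>swap\<close> is unfolded first, so that the congruence facts
    select its branch before the inner one is opened.\<close>
  by (auto simp: swap_def[of "swap p"]) (auto simp: swap_def cong_def)

lemma inj_on_swap: "inj_on swap {0<..}"
  by (rule inj_on_inverseI[of _ swap]) (simp add: swap_swap)

lemma parts_mod_swap:
  assumes "\<And>p. p \<in> set xs \<Longrightarrow> 0 < p"
  shows "parts_mod a m (map swap xs) = parts_mod b m xs"
    and "parts_mod b m (map swap xs) = parts_mod a m xs"
  using assms by (induction xs) (auto simp: parts_mod_def cong_swap_a cong_swap_b)

text \<open>Each part in the class of \<open>a\<close> gains \<open>b - a\<close> and each part in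
  the class of \<open>b\<close> loses it. The balance is written additively to avoid truncated
  subtraction.\<close>

lemma sum_list_swap:
  assumes "\<And>p. p \<in> set xs \<Longrightarrow> 0 < p"
  shows "sum_list (map swap xs) + (b - a) * parts_mod b m xs
       = sum_list xs + (b - a) * parts_mod a m xs"
  using assms
proof (induction xs)
  case Nil
  then show ?case by (simp add: parts_mod_def)
next
  case (Cons p xs)
  have "b \<le> p" if "[p = b] (mod m)" using cong_b_imp_le Cons.prems that by simp
  moreover have "\<not> ([p = a] (mod m) \<and> [p = b] (mod m))"
    using not_cong_a_b by (meson cong_sym cong_trans)
  ultimately show ?case
    using Cons by (auto simp: parts_mod_def swap_def)
qed

lemma mset_map_swap_eqD:
  assumes "mset (map swap xs) = mset (map swap ys)"
    and "\<And>p. p \<in> set xs \<Longrightarrow> 0 < p" "\<And>p. p \<in> set ys \<Longrightarrow> 0 < p"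
  shows "mset xs = mset ys"
proof -
  have "map swap (map swap zs) = zs" if "\<And>p. p \<in> set zs \<Longrightarrow> 0 < p" for zs
    using that by (simp add: map_idI swap_swap)
  then show ?thesis using assms by (metis mset_map)
qed

text \<open>Since \<open>S\<close> avoids both classes, refilling \<open>S\<close> does not alter
  the bias; \<open>step\<close> makes it possible to restore the lost size, and \<open>inj\<close>
  makes the refilling reversible.\<close>

theorem bias_of_subset_sums:
  fixes S :: "nat set" and x :: real
  assumes S: "\<And>s. s \<in> S \<Longrightarrow> 0 < s \<and> \<not> [s = a] (mod m) \<and> \<not> [s = b] (mod m)"
    and inj: "inj_on \<Sum> {A. finite A \<and> A \<subseteq> S}"
    and step: "\<And>A. finite A \<Longrightarrow> A \<subseteq> S \<Longrightarrow> \<exists>B. finite B \<and> B \<subseteq> S \<and> \<Sum>B = \<Sum>A + (b - a)"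
    and x: "0 \<le> x"
  shows "p_bias n b a m x 1 \<le> p_bias n a b m x 1"
proof -
  \<comment> \<open>Iterating \<open>step\<close> makes up for a bias of any size \<open>d\<close>;
    \<open>ext\<close> then fixes one choice of the enlarged set.\<close>
  have "\<exists>B. finite B \<and> B \<subseteq> S \<and> \<Sum>B = \<Sum>A + (b - a) * d" if "finite A" "A \<subseteq> S" for A d
  proof (induction d)
    case (Suc d)
    then obtain B where "finite B" "B \<subseteq> S" "\<Sum>B = \<Sum>A + (b - a) * d" by blast
    with step[of B] show ?case by (metis add.assoc add.commute mult_Suc_right)
  qed (use that in auto)
  then obtain ext where ext: "\<And>A d. finite A \<Longrightarrow> A \<subseteq> S \<Longrightarrow>
      finite (ext A d) \<and> ext A d \<subseteq> S \<and> \<Sum>(ext A d) = \<Sum>A + (b - a) * d"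
    by metis
  define out where "out = filter (\<lambda>p. p \<notin> S)"
  define ins where "ins mu = set (filter (\<lambda>p. p \<in> S) mu)" for mu
  define gap where "gap la mu = parts_mod2 b m la mu - parts_mod2 a m la mu" for la mu
  define new where "new la mu = ext (ins mu) (gap la mu)" for la mu
  \<comment> \<open>All of \<open>la\<close> is swapped, but only the parts of \<open>mu\<close>
    outside \<open>S\<close>. The parts of \<open>mu\<close> in \<open>S\<close> give way to a set
    whose sum exceeds theirs by exactly the size lost in swapping.\<close>
  define \<phi> where "\<phi> = (\<lambda>(la, mu). (desc (map swap la),
      desc (map swap (out mu) @ sorted_list_of_set (new la mu))))"
  have new: "finite (new la mu)" "new la mu \<subseteq> S"
    "\<Sum>(new la mu) = \<Sum>(ins mu) + (b - a) * gap la mu" for la mu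
    using ext[of "ins mu" "gap la mu"] by (auto simp: new_def ins_def)
  \<comment> \<open>If \<open>swap p\<close> were in \<open>S\<close>, it would lie in neither
    class, so neither would \<open>p\<close>; then \<open>swap\<close> fixes \<open>p\<close>, which
    would put \<open>p\<close> itself in \<open>S\<close>.\<close>
  have swap_out: "swap p \<notin> S" if "0 < p" "p \<notin> S" for p
    using S[of "swap p"] that cong_swap_a[of p] cong_swap_b[of p] by (auto simp: swap_def)
  have parts_out: "parts_mod a m (out mu) = parts_mod a m mu"
    "parts_mod b m (out mu) = parts_mod b m mu" for mu
    unfolding out_def using S by (auto intro: parts_mod_filter_notin)
  have parts_new: "parts_mod a m (sorted_list_of_set (new la mu)) = 0"
    "parts_mod b m (sorted_list_of_set (new la mu)) = 0" for la mu
    using S new(1,2)[of la mu] by (auto intro!: parts_mod_eq_0)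
  have maps: "\<phi> q \<in> biased_pairs n a b m" if q: "q \<in> biased_pairs n b a m" for q
  proof -
    obtain la mu where q_eq: "q = (la, mu)" by force
    have pos: "\<And>p. p \<in> set la \<Longrightarrow> 0 < p" "\<And>p. p \<in> set mu \<Longrightarrow> 0 < p" and dist: "distinct mu"
      and sum: "sum_list la + sum_list mu = n"
      and less: "parts_mod2 a m la mu < parts_mod2 b m la mu"
      using q by (auto simp: q_eq biased_pairs_def distinct_partitions_def partitions_def)
    have pos_out: "0 < p" if "p \<in> set (out mu)" for p using that pos by (auto simp: out_def)
    have "desc (map swap la) \<in> partitions"
      using pos swap_pos by (auto intro!: desc_in_partitions)
    moreover have "desc (map swap (out mu) @ sorted_list_of_set (new la mu)) \<in> partitions"
      using pos_out swap_pos S new[of la mu] by (intro desc_in_partitions) auto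
    moreover have "distinct (map swap (out mu) @ sorted_list_of_set (new la mu))"
    proof -
      have "inj_on swap (set (out mu))"
        using pos_out by (auto intro: inj_on_subset[OF inj_on_swap])
      moreover have "swap ` set (out mu) \<inter> new la mu = {}"
      proof -
        have "swap p \<notin> S" if "p \<in> set (out mu)" for p
          using that pos_out[OF that] swap_out[of p] by (auto simp: out_def)
        then show ?thesis using new(2)[of la mu] by blast
      qed
      ultimately show ?thesis
        using dist new(1)[of la mu] by (auto simp: distinct_map out_def)
    qed
    moreover have "sum_list (map swap la) + (sum_list (map swap (out mu)) + \<Sum>(new la mu)) = n"
    proof -
      have "sum_list (filter (\<lambda>p. p \<in> S) mu) = \<Sum>(ins mu)"
        using dist by (simp add: ins_def distinct_sum_list_conv_Sum)
      then have "sum_list (out mu) + \<Sum>(ins mu) = sum_list mu"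
        using sum_list_split_filter[of S mu] by (simp add: out_def)
      \<comment> \<open>The subtraction in \<open>gap\<close> is exact because of
        \<open>less\<close>.\<close>
      moreover have "(b - a) * gap la mu + (b - a) * parts_mod2 a m la mu
          = (b - a) * parts_mod2 b m la mu"
        using less by (simp add: gap_def flip: distrib_left)
      ultimately show ?thesis
        using sum_list_swap[of la, OF pos(1)] sum_list_swap[of "out mu", OF pos_out] new(3)[of la mu] sum
        by (simp add: parts_out parts_mod2_def distrib_left)
    qed
    moreover have "sum_list (sorted_list_of_set (new la mu)) = \<Sum>(new la mu)"
      using new(1) by (simp add: distinct_sum_list_conv_Sum)
    moreover have "parts_mod2 b m (map swap la) (map swap (out mu))
        < parts_mod2 a m (map swap la) (map swap (out mu))"
      using less parts_mod_swap[of la, OF pos(1)] parts_mod_swap[of "out mu", OF pos_out]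
      by (simp add: parts_mod2_def parts_out)
    ultimately show ?thesis
      by (simp add: q_eq \<phi>_def biased_pairs_def distinct_partitions_def parts_mod2_def parts_new)
  qed
  have "inj_on \<phi> (biased_pairs n b a m)"
  proof (rule inj_onI)
    fix q q' assume q: "q \<in> biased_pairs n b a m" "q' \<in> biased_pairs n b a m" and eq: "\<phi> q = \<phi> q'"
    obtain la mu la' mu' where q_eq: "q = (la, mu)" "q' = (la', mu')" by force
    have part: "la \<in> partitions" "mu \<in> partitions" "la' \<in> partitions" "mu' \<in> partitions"
      and dist: "distinct mu" "distinct mu'"
      using q by (auto simp: q_eq biased_pairs_def distinct_partitions_def)
    have pos: "\<And>p. p \<in> set la \<union> set mu \<union> set la' \<union> set mu' \<Longrightarrow> 0 < p"
      using part by (auto simp: partitions_def)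
    have eqs: "mset (map swap la) = mset (map swap la')"
      "mset (map swap (out mu) @ sorted_list_of_set (new la mu))
        = mset (map swap (out mu') @ sorted_list_of_set (new la' mu'))"
      using eq by (simp_all only: q_eq \<phi>_def prod.case prod.inject) (metis mset_desc)+
    have "mset la = mset la'"
      using mset_map_swap_eqD[OF eqs(1)] pos by auto
    then have la: "la = la'" using part partitions_eqI by blast
    \<comment> \<open>Membership in \<open>S\<close> separates the inserted parts of the image from
      the swapped ones, so both can be read off.\<close>
    have filter_out: "filter_mset (\<lambda>p. p \<notin> S)
        (mset (map swap (out nu) @ sorted_list_of_set (new la nu))) = mset (map swap (out nu))"
      and filter_new: "filter_mset (\<lambda>p. p \<in> S)
        (mset (map swap (out nu) @ sorted_list_of_set (new la nu)))
          = mset (sorted_list_of_set (new la nu))"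
      if "nu \<in> {mu, mu'}" for nu
    proof -
      have s: "swap p \<notin> S" if "p \<in> set (out nu)" for p
        using that \<open>nu \<in> {mu, mu'}\<close> pos[of p] swap_out[of p] by (auto simp: out_def)
      have n: "p \<in> S" if "p \<in> set (sorted_list_of_set (new la nu))" for p
        using that new[of la nu] by auto
      show "filter_mset (\<lambda>p. p \<notin> S)
        (mset (map swap (out nu) @ sorted_list_of_set (new la nu))) = mset (map swap (out nu))"
        unfolding mset_filter[symmetric] filter_append
        using s n by (subst filter_True) (auto simp: filter_empty_conv)
      show "filter_mset (\<lambda>p. p \<in> S)
        (mset (map swap (out nu) @ sorted_list_of_set (new la nu)))
          = mset (sorted_list_of_set (new la nu))"
        unfolding mset_filter[symmetric] filter_append
        using s n by (subst (2) filter_True) (auto simp: filter_empty_conv)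
    qed
    have "mset (map swap (out mu)) = mset (map swap (out mu'))"
      using eqs(2) filter_out la by (metis insertCI)
    then have out: "mset (out mu) = mset (out mu')"
      by (rule mset_map_swap_eqD) (simp_all add: out_def pos)
    have "mset (sorted_list_of_set (new la mu)) = mset (sorted_list_of_set (new la mu'))"
      using eqs(2) filter_new la by (metis insertCI)
    then have "new la mu = new la mu'"
      using new(1) by (metis mset_eq_setD set_sorted_list_of_set)
    \<comment> \<open>All parts of \<open>mu\<close> in the two classes lie outside
      \<open>S\<close>, so the recovered outer parts and \<open>la\<close> determine the gap.
      Subtracting its contribution from the sum of the inserted set leaves the original subset sum,
      and \<open>inj\<close> returns the original subset.\<close>
    moreover have "parts_mod c m (out mu) = parts_mod c m (out mu')" for c
      using out by (simp add: parts_mod_mset)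
    then have "parts_mod a m mu = parts_mod a m mu'" "parts_mod b m mu = parts_mod b m mu'"
      using parts_out by metis+
    then have "gap la mu = gap la mu'"
      by (simp add: gap_def parts_mod2_def)
    ultimately have "\<Sum>(ins mu) = \<Sum>(ins mu')"
      using new(3)[of la mu] new(3)[of la mu'] by simp
    then have "ins mu = ins mu'"
      by (rule inj_onD[OF inj]) (auto simp: ins_def)
    moreover have "set (out mu) = set (out mu')" using out by (rule mset_eq_setD)
    ultimately have "set mu = set mu'"
      unfolding ins_def out_def set_filter by blast
    then have "mset mu = mset mu'" using dist by (simp add: set_eq_iff_mset_eq_distinct)
    then show "q = q'" using la part partitions_eqI by (simp add: q_eq)
  qed
  \<comment> \<open>With \<open>y = 1\<close> the weight depends only on the length of the first
    component, which \<phi> keeps.\<close>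
  moreover have "(\<Sum>(la, mu)\<in>biased_pairs n b a m. x ^ length la)
      = (\<Sum>q\<in>biased_pairs n b a m. (\<lambda>(la, mu). x ^ length la) (\<phi> q))"
    by (intro sum.cong) (auto simp: \<phi>_def)
  ultimately have "(\<Sum>(la, mu)\<in>biased_pairs n b a m. x ^ length la)
      = (\<Sum>(la, mu)\<in>\<phi> ` biased_pairs n b a m. x ^ length la)"
    by (simp add: sum.reindex)
  also have "\<dots> \<le> (\<Sum>(la, mu)\<in>biased_pairs n a b m. x ^ length la)"
    using maps x by (intro sum_mono2) (auto simp: finite_biased_pairs)
  finally show ?thesis by (simp add: p_bias_def)
qed

end

section \<open>Subset sums of \<open>k, 2k, 4k, ...\<close> as binary expansions\<close>

lemma subset_range_binary:
  fixes k :: nat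
  assumes "0 < k" "finite A" "A \<subseteq> range (\<lambda>h. 2 ^ h * k)"
  obtains H where "finite H" "A = (\<lambda>h. 2 ^ h * k) ` H" "\<Sum>A = k * set_encode H"
proof -
  have inj: "inj_on (\<lambda>h. 2 ^ h * k) H" for H
    using assms(1) by (auto intro!: inj_onI)
  obtain H where H: "finite H" "A = (\<lambda>h. 2 ^ h * k) ` H"
    using assms(2,3) by (metis finite_subset_image)
  have "\<Sum>A = (\<Sum>h\<in>H. 2 ^ h * k)" unfolding H(2) by (simp add: sum.reindex[OF inj])
  also have "\<dots> = k * set_encode H"
    by (simp add: set_encode_def sum_distrib_left mult.commute)
  finally show ?thesis using that H by blast
qed

text \<open>Uniqueness of binary expansions: \<open>set_decode\<close> inverts
  \<open>set_encode\<close> on finite sets.\<close>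

lemma subset_sums_binary:
  fixes k :: nat
  assumes "0 < k"
  shows "inj_on \<Sum> {A. finite A \<and> A \<subseteq> range (\<lambda>h. 2 ^ h * k)}"
proof (rule inj_onI, clarify)
  fix A B :: "nat set"
  assume *: "finite A" "A \<subseteq> range (\<lambda>h. 2 ^ h * k)" "finite B" "B \<subseteq> range (\<lambda>h. 2 ^ h * k)"
    "\<Sum>A = \<Sum>B"
  obtain H where H: "finite H" "A = (\<lambda>h. 2 ^ h * k) ` H" "\<Sum>A = k * set_encode H"
    using subset_range_binary[OF assms *(1,2)] .
  obtain K where K: "finite K" "B = (\<lambda>h. 2 ^ h * k) ` K" "\<Sum>B = k * set_encode K"
    using subset_range_binary[OF assms *(3,4)] .
  have "set_encode H = set_encode K" using H K *(5) assms by simp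
  then have "H = K" using H(1) K(1) by (metis set_encode_inverse)
  then show "A = B" using H K by simp
qed

text \<open>Existence of binary expansions: the positions of the binary ones of \<open>w\<close>
  select the summands.\<close>

lemma ex_subset_sum_binary:
  fixes k w :: nat
  assumes "0 < k"
  shows "\<exists>B. finite B \<and> B \<subseteq> range (\<lambda>h. 2 ^ h * k) \<and> \<Sum>B = k * w"
proof -
  have inj: "inj_on (\<lambda>h. 2 ^ h * k) H" for H
    using assms(1) by (auto intro!: inj_onI)
  have "(\<Sum>h\<in>set_decode w. 2 ^ h * k) = k * set_encode (set_decode w)"
    by (simp add: set_encode_def sum_distrib_left mult.commute)
  then have "\<Sum>((\<lambda>h. 2 ^ h * k) ` set_decode w) = k * w"
    by (simp add: sum.reindex[OF inj])
  then show ?thesis by (intro exI[of _ "(\<lambda>h. 2 ^ h * k) ` set_decode w"]) auto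
qed

section \<open>Choice of the set \<open>S\<close>\<close>

context residue_pair
begin

lemma bias_binary:
  assumes "0 < k" "k dvd b - a"
    and "\<And>h. \<not> [2 ^ h * k = a] (mod m) \<and> \<not> [2 ^ h * k = b] (mod m)"
    and "(0::real) \<le> x"
  shows "p_bias n b a m x 1 \<le> p_bias n a b m x 1"
proof (rule bias_of_subset_sums[where S = "range (\<lambda>h. 2 ^ h * k)"])
  fix A assume A: "finite A" "A \<subseteq> range (\<lambda>h. 2 ^ h * k)"
  obtain H where "\<Sum>A = k * set_encode H" using subset_range_binary[OF assms(1) A] by metis
  moreover obtain t where "b - a = k * t" using assms(2) by blast
  ultimately show "\<exists>B. finite B \<and> B \<subseteq> range (\<lambda>h. 2 ^ h * k) \<and> \<Sum>B = \<Sum>A + (b - a)"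
    using ex_subset_sum_binary[OF assms(1), of "set_encode H + t"] by (simp add: distrib_left)
qed (use assms subset_sums_binary in auto)

text \<open>Even multiples of \<open>k\<close> are sums of the doubled powers alone, and odd
  multiples from \<open>3 * k\<close> on arise by adding \<open>3 * k\<close>. Only \<open>k\<close>
  itself is missed.\<close>

lemma bias_binary_with_triple:
  fixes k t :: nat
  assumes k: "0 < k" and t: "b - a = k * t" "odd t" "t \<noteq> 1"
    and pow: "\<And>h. \<not> [2 ^ h * (2 * k) = a] (mod m) \<and> \<not> [2 ^ h * (2 * k) = b] (mod m)"
    and triple: "\<not> [3 * k = a] (mod m)" "\<not> [3 * k = b] (mod m)"
    and x: "(0::real) \<le> x"
  shows "p_bias n b a m x 1 \<le> p_bias n a b m x 1"
proof -
  define R where "R = range (\<lambda>h. 2 ^ h * (2 * k))"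
  have k2: "0 < 2 * k" using k by simp
  have notin: "3 * k \<notin> R"
  proof
    assume "3 * k \<in> R"
    then obtain h where "3 * k = 2 ^ h * (2 * k)" by (auto simp: R_def)
    then have "3 = 2 * (2::nat) ^ h" using k by simp
    then show False by presburger
  qed
  have split: "\<exists>w. \<Sum>(A - {3 * k}) = 2 * k * w \<and> \<Sum>A = k * (2 * w + (if 3 * k \<in> A then 3 else 0))"
    if A: "finite A" "A \<subseteq> insert (3 * k) R" for A
  proof -
    have "finite (A - {3 * k})" "A - {3 * k} \<subseteq> range (\<lambda>h. 2 ^ h * (2 * k))"
      using A by (auto simp: R_def)
    then obtain w where w: "\<Sum>(A - {3 * k}) = 2 * k * w"
      using subset_range_binary[OF k2] by metis
    moreover have "\<Sum>A = \<Sum>(A - {3 * k}) + (if 3 * k \<in> A then 3 * k else 0)"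
      using A(1) by (simp add: sum.remove)
    ultimately show ?thesis by (auto simp: algebra_simps)
  qed
  show ?thesis
  proof (rule bias_of_subset_sums[where S = "insert (3 * k) R"])
    show "inj_on \<Sum> {A. finite A \<and> A \<subseteq> insert (3 * k) R}"
    proof (rule inj_onI, clarify)
      fix A B assume A: "finite A" "A \<subseteq> insert (3 * k) R"
        and B: "finite B" "B \<subseteq> insert (3 * k) R" and eq: "\<Sum>A = \<Sum>B"
      obtain v where v: "\<Sum>(A - {3 * k}) = 2 * k * v"
        "\<Sum>A = k * (2 * v + (if 3 * k \<in> A then 3 else 0))" using split[OF A] by blast
      obtain w where w: "\<Sum>(B - {3 * k}) = 2 * k * w"
        "\<Sum>B = k * (2 * w + (if 3 * k \<in> B then 3 else 0))" using split[OF B] by blast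
      \<comment> \<open>The parity of the multiple of \<open>k\<close> reveals whether
        \<open>3 * k\<close> is used; the rest is a binary expansion, hence unique.\<close>
      have "2 * v + (if 3 * k \<in> A then 3 else 0) = 2 * w + (if 3 * k \<in> B then 3 else 0)"
        using eq k unfolding v(2) w(2) by simp
      then have same: "3 * k \<in> A \<longleftrightarrow> 3 * k \<in> B" and "v = w"
        by (auto split: if_splits; presburger)+
      then have "\<Sum>(A - {3 * k}) = \<Sum>(B - {3 * k})" using v w by simp
      then have "A - {3 * k} = B - {3 * k}"
        using A B by (rule_tac inj_onD[OF subset_sums_binary[OF k2]]) (auto simp: R_def)
      then show "A = B" using same by blast
    qed
  next
    fix A assume A: "finite A" "A \<subseteq> insert (3 * k) R"
    obtain v where "\<Sum>A = k * (2 * v + (if 3 * k \<in> A then 3 else 0))" using split[OF A] by blast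
    then obtain u where u: "\<Sum>A + (b - a) = k * u" "3 \<le> u"
    proof -
      \<comment> \<open>An odd \<open>t\<close> other than 1 is at least 3, so adding
        \<open>b - a\<close> never lands on the missed multiple \<open>k\<close>.\<close>
      have "3 \<le> t" using t(2,3) by presburger
      then show ?thesis
        using that[of "2 * v + (if 3 * k \<in> A then 3 else 0) + t"]
          \<open>\<Sum>A = k * (2 * v + (if 3 * k \<in> A then 3 else 0))\<close> t(1)
        by (simp add: distrib_left)
    qed
    show "\<exists>B. finite B \<and> B \<subseteq> insert (3 * k) R \<and> \<Sum>B = \<Sum>A + (b - a)"
    proof (cases "even u")
      case True
      then obtain w where "u = 2 * w" by blast
      then show ?thesis
        using ex_subset_sum_binary[OF k2, of w] u(1) by (auto simp: R_def ac_simps)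
    next
      case False
      then obtain w where w: "u = 2 * w + 3" using u(2)
        by (metis add.commute le_add_diff_inverse odd_numeral odd_add dvd_def)
      obtain B where B: "finite B" "B \<subseteq> R" "\<Sum>B = 2 * k * w"
        using ex_subset_sum_binary[OF k2, of w] by (auto simp: R_def)
      then have "\<Sum>(insert (3 * k) B) = \<Sum>A + (b - a)"
        using notin u(1) w by (subst sum.insert) (auto simp: algebra_simps)
      then show ?thesis using B by (intro exI[of _ "insert (3 * k) B"]) auto
    qed
  qed (use k pow triple x in \<open>auto simp: R_def\<close>)
qed

lemma bias_of_divisor_a:
  assumes dvd: "a dvd b - a"
    and pow: "\<And>h. \<not> [2 ^ h * (2 * a) = a] (mod m) \<and> \<not> [2 ^ h * (2 * a) = b] (mod m)"
    and x: "(0::real) \<le> x"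
  shows "p_bias n b a m x 1 \<le> p_bias n a b m x 1"
proof -
  obtain t where t: "b - a = a * t" using dvd by blast
  show ?thesis
  proof (cases "even t")
    case True
    then have "2 * a dvd b - a" using t by auto
    then show ?thesis using bias_binary[of "2 * a"] pow x a_pos by simp
  next
    case False
    have b: "b = a * t + a" using t a_less_b by simp
    \<comment> \<open>The quotients 1 and 3 would give \<open>b = 2 * a\<close> and
      \<open>b = 4 * a\<close>, which \<open>pow\<close> excludes at \<open>h = 0\<close> and
      \<open>h = 1\<close>.\<close>
    have "t \<noteq> 1" using pow[of 0] b by (auto simp flip: mult_2)
    moreover have "t \<noteq> 3" using pow[of 1] b by auto
    ultimately have "5 \<le> t" using False by presburger
    \<comment> \<open>Now \<open>b \<ge> 6 * a\<close>, so \<open>3 * a\<close> lies strictly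
      between \<open>a\<close> and \<open>b \<le> m\<close> and is congruent to neither; for
      \<open>b = m\<close> the residue of \<open>b\<close> is 0.\<close>
    then have "a * 5 \<le> a * t" by simp
    then have "3 * a < b" "a < m" using b b_le_m a_pos by linarith+
    then have "\<not> [3 * a = a] (mod m)" "\<not> [3 * a = b] (mod m)"
      using a_pos b_le_m by (cases "b = m"; simp add: cong_def)+
    then show ?thesis
      using bias_binary_with_triple[OF _ t False] \<open>t \<noteq> 1\<close> pow x a_pos by simp
  qed
qed

end

section \<open>The cases \<open>k = a\<close> and \<open>k \<noteq> a\<close>\<close>

theorem theorem1p2:
  fixes x :: real and a b m n :: nat
  assumes "x \<ge> 0"
    and "1 \<le> a" and "a < b" and "b \<le> m"
    and "\<exists>k::nat. k > 0 \<and> k dvd (b - a) \<and>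
           (\<forall>h::nat. h \<ge> 1 \<longrightarrow> \<not> [2 ^ h * k = a] (mod m) \<and> \<not> [2 ^ h * k = b] (mod m))"
  shows "p_bias n a b m x 1 \<ge> p_bias n b a m x 1"
proof -
  interpret residue_pair a b m using assms by unfold_locales
  obtain k where k: "k > 0" "k dvd (b - a)"
    and pow: "\<And>h. h \<ge> 1 \<Longrightarrow> \<not> [2 ^ h * k = a] (mod m) \<and> \<not> [2 ^ h * k = b] (mod m)"
    using assms(5) by blast
  show ?thesis
  proof (cases "k = a")
    case True
    \<comment> \<open>Starting the powers at \<open>2 * a\<close> shifts the exponent by one, so the
      hypothesis for \<open>h \<ge> 1\<close> covers every \<open>h\<close> here.\<close>
    have "\<not> [2 ^ h * (2 * a) = a] (mod m) \<and> \<not> [2 ^ h * (2 * a) = b] (mod m)" for h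
      using pow[of "Suc h"] True by (simp add: ac_simps)
    then show ?thesis using bias_of_divisor_a k True assms(1) by blast
  next
    case False
    \<comment> \<open>The hypothesis is silent about \<open>h = 0\<close>. There
      \<open>0 < k \<le> b - a < b \<le> m\<close> together with \<open>k \<noteq> a\<close> keeps
      \<open>k\<close> out of both classes.\<close>
    have "k \<le> b - a" using k assms(3) by (simp add: dvd_imp_le)
    then have "k < b" "k < m" "a < m" using assms by linarith+
    then have "\<not> [k = a] (mod m)" "\<not> [k = b] (mod m)"
      using False k(1) assms(4) by (cases "b = m"; simp add: cong_def)+
    then have "\<not> [2 ^ h * k = a] (mod m) \<and> \<not> [2 ^ h * k = b] (mod m)" for h
      using pow[of h] by (cases "h = 0") auto
    then show ?thesis using bias_binary k assms(1) by blast
  qed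
qed

end
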